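(* Let $T \ge 1$, let $\{x_t,y_t\}_{t\in[T]}$ be any sequence with $x_t\in X$, $y_t\in Y$, let $\{\theta_t\}_{t\in[T]}$ be nonnegative weights with $\Theta_T := \sum_{t\in[T]}\theta_t > 0$, and put $$\bar{x}_T^\theta := \frac{1}{\Theta_T}\sum_{t\in[T]}\theta_t x_t,\qquad \bar{y}_T^\theta := \frac{1}{\Theta_T}\sum_{t\in[T]}\theta_t y_t .$$ Then, for the parameter $p\in P$ and any data sequence $\{p_t\}_{t\in[T]}\subseteq P$, $$\epsilon_{\mathrm{sad}}^{\Psi}\left(\bar{x}_T^\theta,\bar{y}_T^\theta;p\right)\le \widehat{\epsilon}+\epsilon^\circ+\epsilon^\bullet,$$ where $$\widehat{\epsilon} := \max_{y\in Y}\frac{1}{\Theta_T}\sum_{t\in[T]}\theta_t\Psi(x_t,y;p_t)-\min_{x\in X}\frac{1}{\Theta_T}\sum_{t\in[T]}\theta_t\Psi(x,y_t;p_t),$$ $$\epsilon^\circ := \max_{y\in Y}\frac{1}{\Theta_T}\sum_{t\in[T]}\theta_t\left[\Psi(x_t,y;p)-\Psi(x_t,y;p_t)\right],$$ $$\epsilon^\bullet := \max_{x\in X}\frac{1}{\Theta_T}\sum_{t\in[T]}\theta_t\left[\Psi(x,y_t;p_t)-\Psi(x,y_t;p)\right].$$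
   Context: $[T]=\{1,\dots,T\}$. $X$ and $Y$ are nonempty convex compact subsets of Euclidean spaces and $P$ is a parameter (data) space. $\Psi: X\times Y\times P\to\mathbb{R}$, written $\Psi(x,y;p)$, is such that for every $p\in P$ the function $\Psi(\cdot,\cdot;p)$ is convex in $x$ and concave in $y$. All maxima and minima written are assumed to be attained (e.g. $\Psi(\cdot,\cdot;p)$ is continuous). The saddle point gap of $(\bar x,\bar y)\in X\times Y$ at $p$ is $$\epsilon_{\mathrm{sad}}^{\Psi}(\bar x,\bar y;p):=\max_{y\in Y}\Psi(\bar x,y;p)-\min_{x\in X}\Psi(x,\bar y;p).$$ *)

theory Defs
  imports "HOL-Analysis.Analysis"
begin

definition attains_max :: "'a set \<Rightarrow> ('a \<Rightarrow> real) \<Rightarrow> bool" where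
  "attains_max S f \<longleftrightarrow> (\<exists>z\<in>S. \<forall>w\<in>S. f w \<le> f z)"

definition attains_min :: "'a set \<Rightarrow> ('a \<Rightarrow> real) \<Rightarrow> bool" where
  "attains_min S f \<longleftrightarrow> (\<exists>z\<in>S. \<forall>w\<in>S. f z \<le> f w)"

text \<open>
  A maximum (minimum) over a possibly infinite set is written as \<open>SUP\<close> (\<open>INF\<close>) below.  On the
  reals these agree with the maximum (minimum) only when it is attained, so the functions concerned
  have to be assumed to satisfy \<^const>\<open>attains_max\<close> (\<^const>\<open>attains_min\<close>).
\<close>

definition saddle_gap ::
    "'a set \<Rightarrow> 'b set \<Rightarrow> ('a \<Rightarrow> 'b \<Rightarrow> 'p \<Rightarrow> real) \<Rightarrow> 'a \<Rightarrow> 'b \<Rightarrow> 'p \<Rightarrow> real" where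
  "saddle_gap X Y \<Psi> xb yb p = (SUP y\<in>Y. \<Psi> xb y p) - (INF x\<in>X. \<Psi> x yb p)"

text \<open>
  Also used for real-valued \<open>z\<close>, where \<open>*\<^sub>R\<close> is ordinary multiplication.
\<close>

definition weighted_avg :: "nat \<Rightarrow> (nat \<Rightarrow> real) \<Rightarrow> (nat \<Rightarrow> 'a::real_vector) \<Rightarrow> 'a" where
  "weighted_avg T \<theta> z = (1 / (\<Sum>t=1..T. \<theta> t)) *\<^sub>R (\<Sum>t=1..T. \<theta> t *\<^sub>R z t)"

definition eps_hat ::
    "'a set \<Rightarrow> 'b set \<Rightarrow> ('a \<Rightarrow> 'b \<Rightarrow> 'p \<Rightarrow> real) \<Rightarrow> nat \<Rightarrow> (nat \<Rightarrow> real) \<Rightarrow>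
      (nat \<Rightarrow> 'a) \<Rightarrow> (nat \<Rightarrow> 'b) \<Rightarrow> (nat \<Rightarrow> 'p) \<Rightarrow> real" where
  "eps_hat X Y \<Psi> T \<theta> x y q =
     (SUP v\<in>Y. weighted_avg T \<theta> (\<lambda>t. \<Psi> (x t) v (q t))) -
     (INF u\<in>X. weighted_avg T \<theta> (\<lambda>t. \<Psi> u (y t) (q t)))"

definition eps_circ ::
    "'b set \<Rightarrow> ('a \<Rightarrow> 'b \<Rightarrow> 'p \<Rightarrow> real) \<Rightarrow> nat \<Rightarrow> (nat \<Rightarrow> real) \<Rightarrow>
      (nat \<Rightarrow> 'a) \<Rightarrow> (nat \<Rightarrow> 'p) \<Rightarrow> 'p \<Rightarrow> real" where
  "eps_circ Y \<Psi> T \<theta> x q p =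
     (SUP v\<in>Y. weighted_avg T \<theta> (\<lambda>t. \<Psi> (x t) v p - \<Psi> (x t) v (q t)))"

definition eps_bullet ::
    "'a set \<Rightarrow> ('a \<Rightarrow> 'b \<Rightarrow> 'p \<Rightarrow> real) \<Rightarrow> nat \<Rightarrow> (nat \<Rightarrow> real) \<Rightarrow>
      (nat \<Rightarrow> 'b) \<Rightarrow> (nat \<Rightarrow> 'p) \<Rightarrow> 'p \<Rightarrow> real" where
  "eps_bullet X \<Psi> T \<theta> y q p =
     (SUP u\<in>X. weighted_avg T \<theta> (\<lambda>t. \<Psi> u (y t) (q t) - \<Psi> u (y t) p))"

end

theory Submission
  imports Defs
begin

text \<open>
  The two players are handled separately.  For a fixed \<open>v \<in> Y\<close>, Jensen's inequality bounds
  \<open>\<Psi>\<close> at the averaged \<open>x\<close>, at \<open>v\<close> and \<open>p\<close>, by the average of the values \<open>\<Psi> (x t) v p\<close>.  Averaging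
  is linear, so this is the average of \<open>\<Psi> (x t) v (q t)\<close> plus the average of the data errors
  \<open>\<Psi> (x t) v p - \<Psi> (x t) v (q t)\<close>.
  These two terms are at most the maximum in the definition of \<^const>\<open>eps_hat\<close> and
  \<^const>\<open>eps_circ\<close> respectively.  Concavity in the second argument gives the mirror image: at each
  \<open>u \<in> X\<close> and the averaged \<open>y\<close>, \<open>\<Psi>\<close> is at least the minimum in \<^const>\<open>eps_hat\<close> minus
  \<^const>\<open>eps_bullet\<close>.  Subtracting the two bounds gives the claim.

  Attainment of the maxima and the minimum on the right-hand side makes the sets of values
  bounded, which is what allows a value at a single point to be compared with a real supremum or
  infimum.
\<close>

lemma attains_max_imp_le_SUP:
  assumes "attains_max S f" "w \<in> S"
  shows "f w \<le> (SUP z\<in>S. f z)"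
  using assms unfolding attains_max_def by (auto intro!: cSUP_upper bdd_aboveI2)

lemma attains_min_imp_INF_le:
  assumes "attains_min S f" "w \<in> S"
  shows "(INF z\<in>S. f z) \<le> f w"
  using assms unfolding attains_min_def by (auto intro!: cINF_lower bdd_belowI2)

lemma weighted_avg_add:
  "weighted_avg T \<theta> (\<lambda>t. f t + g t) = weighted_avg T \<theta> f + weighted_avg T \<theta> g"
  by (simp add: weighted_avg_def scaleR_add_right sum.distrib)

lemma weighted_avg_uminus:
  "weighted_avg T \<theta> (\<lambda>t. - f t) = - weighted_avg T \<theta> f"
  by (simp add: weighted_avg_def sum_negf)

text \<open>
  Jensen's inequality: after normalisation by the positive total weight, the average is a convex
  combination of the points.
\<close>

lemma convex_on_weighted_avg_le:
  fixes f :: "'a::real_vector \<Rightarrow> real"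
  assumes "convex_on S f"
    and "\<And>t. t \<in> {1..T} \<Longrightarrow> z t \<in> S"
    and "\<And>t. t \<in> {1..T} \<Longrightarrow> \<theta> t \<ge> 0"
    and pos: "(\<Sum>t=1..T. \<theta> t) > 0"
  shows "f (weighted_avg T \<theta> z) \<le> weighted_avg T \<theta> (\<lambda>t. f (z t))"
proof -
  define \<Theta> where "\<Theta> = (\<Sum>t=1..T. \<theta> t)"
  have "\<Theta> > 0"
    using pos by (simp add: \<Theta>_def)
  have avg: "weighted_avg T \<theta> h = (\<Sum>t=1..T. (\<theta> t / \<Theta>) *\<^sub>R h t)"
    for h :: "nat \<Rightarrow> 'c::real_vector"
    by (simp add: weighted_avg_def \<Theta>_def scaleR_sum_right)
  have "{1..T} \<noteq> {}"
    using pos by force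
  moreover have "(\<Sum>t=1..T. \<theta> t / \<Theta>) = 1"
    using \<open>\<Theta> > 0\<close> by (simp add: \<Theta>_def flip: sum_divide_distrib)
  ultimately have "f (\<Sum>t=1..T. (\<theta> t / \<Theta>) *\<^sub>R z t) \<le> (\<Sum>t=1..T. \<theta> t / \<Theta> * f (z t))"
    using assms(1-3) \<open>\<Theta> > 0\<close> by (intro convex_on_sum[where C = S]) auto
  then show ?thesis
    by (simp add: avg)
qed

lemma concave_on_weighted_avg_ge:
  fixes f :: "'a::real_vector \<Rightarrow> real"
  assumes "concave_on S f"
    and "\<And>t. t \<in> {1..T} \<Longrightarrow> z t \<in> S"
    and "\<And>t. t \<in> {1..T} \<Longrightarrow> \<theta> t \<ge> 0"
    and "(\<Sum>t=1..T. \<theta> t) > 0"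
  shows "weighted_avg T \<theta> (\<lambda>t. f (z t)) \<le> f (weighted_avg T \<theta> z)"
  using convex_on_weighted_avg_le[of S "\<lambda>u. - f u" T z \<theta>] assms
  by (simp add: concave_on_def weighted_avg_uminus)

theorem theorem1:
  fixes X :: "'a::euclidean_space set" and Y :: "'b::euclidean_space set" and P :: "'p set"
    and \<Psi> :: "'a \<Rightarrow> 'b \<Rightarrow> 'p \<Rightarrow> real"
    and T :: nat and x :: "nat \<Rightarrow> 'a" and y :: "nat \<Rightarrow> 'b" and \<theta> :: "nat \<Rightarrow> real"
    and p :: 'p and q :: "nat \<Rightarrow> 'p"
  assumes X: "X \<noteq> {}" "convex X" "compact X"
    and Y: "Y \<noteq> {}" "convex Y" "compact Y"
    and convex_in_x: "\<And>r v. r \<in> P \<Longrightarrow> v \<in> Y \<Longrightarrow> convex_on X (\<lambda>u. \<Psi> u v r)"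
    and concave_in_y: "\<And>r u. r \<in> P \<Longrightarrow> u \<in> X \<Longrightarrow> concave_on Y (\<lambda>v. \<Psi> u v r)"
    and T: "T \<ge> 1"
    and x: "\<And>t. t \<in> {1..T} \<Longrightarrow> x t \<in> X"
    and y: "\<And>t. t \<in> {1..T} \<Longrightarrow> y t \<in> Y"
    and weights_nonneg: "\<And>t. t \<in> {1..T} \<Longrightarrow> \<theta> t \<ge> 0"
    and weights_pos: "(\<Sum>t=1..T. \<theta> t) > 0"
    and p: "p \<in> P"
    and q: "\<And>t. t \<in> {1..T} \<Longrightarrow> q t \<in> P"
    and attained_gap:
      "attains_max Y (\<lambda>v. \<Psi> (weighted_avg T \<theta> x) v p)"
      "attains_min X (\<lambda>u. \<Psi> u (weighted_avg T \<theta> y) p)"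
    and attained_hat:
      "attains_max Y (\<lambda>v. weighted_avg T \<theta> (\<lambda>t. \<Psi> (x t) v (q t)))"
      "attains_min X (\<lambda>u. weighted_avg T \<theta> (\<lambda>t. \<Psi> u (y t) (q t)))"
    and attained_circ:
      "attains_max Y (\<lambda>v. weighted_avg T \<theta> (\<lambda>t. \<Psi> (x t) v p - \<Psi> (x t) v (q t)))"
    and attained_bullet:
      "attains_max X (\<lambda>u. weighted_avg T \<theta> (\<lambda>t. \<Psi> u (y t) (q t) - \<Psi> u (y t) p))"
  shows "saddle_gap X Y \<Psi> (weighted_avg T \<theta> x) (weighted_avg T \<theta> y) p
           \<le> eps_hat X Y \<Psi> T \<theta> x y q + eps_circ Y \<Psi> T \<theta> x q p + eps_bullet X \<Psi> T \<theta> y q p"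
proof -
  have max_bound: "(SUP v\<in>Y. \<Psi> (weighted_avg T \<theta> x) v p)
      \<le> (SUP v\<in>Y. weighted_avg T \<theta> (\<lambda>t. \<Psi> (x t) v (q t))) + eps_circ Y \<Psi> T \<theta> x q p"
  proof (rule cSUP_least[OF Y(1)])
    fix v assume "v \<in> Y"
    have "\<Psi> (weighted_avg T \<theta> x) v p \<le> weighted_avg T \<theta> (\<lambda>t. \<Psi> (x t) v p)"
      using convex_on_weighted_avg_le[OF convex_in_x[OF p \<open>v \<in> Y\<close>] x weights_nonneg weights_pos] .
    also have "\<dots> = weighted_avg T \<theta> (\<lambda>t. \<Psi> (x t) v (q t))
        + weighted_avg T \<theta> (\<lambda>t. \<Psi> (x t) v p - \<Psi> (x t) v (q t))"
      by (simp flip: weighted_avg_add)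
    also have "\<dots> \<le> (SUP v\<in>Y. weighted_avg T \<theta> (\<lambda>t. \<Psi> (x t) v (q t))) + eps_circ Y \<Psi> T \<theta> x q p"
      unfolding eps_circ_def
      by (intro add_mono attains_max_imp_le_SUP[OF attained_hat(1) \<open>v \<in> Y\<close>]
          attains_max_imp_le_SUP[OF attained_circ \<open>v \<in> Y\<close>])
    finally show "\<Psi> (weighted_avg T \<theta> x) v p
      \<le> (SUP v\<in>Y. weighted_avg T \<theta> (\<lambda>t. \<Psi> (x t) v (q t))) + eps_circ Y \<Psi> T \<theta> x q p" .
  qed
  have min_bound: "(INF u\<in>X. weighted_avg T \<theta> (\<lambda>t. \<Psi> u (y t) (q t))) - eps_bullet X \<Psi> T \<theta> y q p
      \<le> (INF u\<in>X. \<Psi> u (weighted_avg T \<theta> y) p)"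
  proof (rule cINF_greatest[OF X(1)])
    fix u assume "u \<in> X"
    have "(INF u\<in>X. weighted_avg T \<theta> (\<lambda>t. \<Psi> u (y t) (q t)))
        \<le> weighted_avg T \<theta> (\<lambda>t. \<Psi> u (y t) (q t))"
      by (rule attains_min_imp_INF_le[OF attained_hat(2) \<open>u \<in> X\<close>])
    also have "\<dots> = weighted_avg T \<theta> (\<lambda>t. \<Psi> u (y t) p)
        + weighted_avg T \<theta> (\<lambda>t. \<Psi> u (y t) (q t) - \<Psi> u (y t) p)"
      by (simp flip: weighted_avg_add)
    also have "\<dots> \<le> \<Psi> u (weighted_avg T \<theta> y) p + eps_bullet X \<Psi> T \<theta> y q p"
      unfolding eps_bullet_def
      by (intro add_mono attains_max_imp_le_SUP[OF attained_bullet \<open>u \<in> X\<close>]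
          concave_on_weighted_avg_ge[OF concave_in_y[OF p \<open>u \<in> X\<close>] y weights_nonneg weights_pos])
    finally show "(INF u\<in>X. weighted_avg T \<theta> (\<lambda>t. \<Psi> u (y t) (q t))) - eps_bullet X \<Psi> T \<theta> y q p
        \<le> \<Psi> u (weighted_avg T \<theta> y) p"
      by simp
  qed
  show ?thesis
    using max_bound min_bound unfolding saddle_gap_def eps_hat_def by linarith
qed

end
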